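(* Let $P$ be a (finite, ground) CR-Prolog program. If $P$ is acyclic and cr-independent, then $P$ has the antichain property: for all answer sets $X_1, X_2$ of $P$, if $X_1 \subseteq X_2$ then $X_1 = X_2$.
   Context: An atom is a propositional symbol; a literal is an atom $a$ or its classical negation $\neg a$; two literals are complementary if one is the classical negation of the other. A context is a set of literals; it is consistent if it contains no complementary pair. All contexts considered are consistent. A regular rule $r$ has the form $l_1 \vee \dots \vee l_k \leftarrow l_{k+1},\dots,l_m, \mathrm{not}\ l_{m+1},\dots,\mathrm{not}\ l_n$ with literals $l_i$ and $1\le k\le m\le n$; $\mathrm{head}(r)=\{l_1,\dots,l_k\}$ and $\mathrm{pos}(r)=\{l_{k+1},\dots,l_m\}$. A context $X$ satisfies the body of $r$ (and $r$ fires w.r.t. $X$) if $l_{k+1},\dots,l_m\in X$ and $l_{m+1},\dots,l_n\notin X$; $X$ satisfies $r$ if, whenever $r$ fires w.r.t. $X$, $\mathrm{head}(r)\cap X\neq\emptyset$; $X$ satisfies a set of regular rules if it satisfies each of them. An A-Prolog program is a finite set of regular rules. If $P$ is an A-Prolog program without default negation (every rule has $m=n$), $X$ is an answer set of $P$ if $X$ satisfies $P$ and no proper subset of $X$ satisfies $P$. For a general A-Prolog program $P$, the reduct $P^X$ is obtained by removing every rule containing some $\mathrm{not}\ l$ with $l\in X$ and then deleting all remaining extended literals $\mathrm{not}\ l$ from the remaining rules; $X$ is an answer set of $P$ if $X$ is an answer set of $P^X$. $P$ is consistent if it has an answer set. A cr-rule has the form $l_0 \stackrel{+}{\leftarrow}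 l_1,\dots,l_m,\mathrm{not}\ l_{m+1},\dots,\mathrm{not}\ l_n$, with $\mathrm{head}=\{l_0\}$ and $\mathrm{pos}=\{l_1,\dots,l_m\}$; $l_0$ is called a cr-literal. A CR-Prolog program $P$ is a finite set of regular rules and cr-rules; $P^{reg}$ denotes its regular rules and $P^{cr}$ its cr-rules. The application $\alpha(r)$ of a cr-rule $r$ is the regular rule obtained by replacing $\stackrel{+}{\leftarrow}$ by $\leftarrow$; $\alpha(R)=\{\alpha(r): r\in R\}$. A set $R\subseteq P^{cr}$ is an abductive support of $P$ if the A-Prolog program $P^{reg}\cup\alpha(R)$ is consistent and there is no $R'\subseteq P^{cr}$ with $|R'|<|R|$ such that $P^{reg}\cup\alpha(R')$ is consistent. A context $X$ is an answer set of $P$ if $X$ is an answer set of $P^{reg}\cup\alpha(R)$ for some abductive support $R$ of $P$. The dependency graph of a program $P$ has the literals of $P$ as vertices and a directed edge from $l_2$ to $l_1$ iff some rule $r\in P$ (regular or cr-rule) has $l_1\in\mathrm{head}(r)$ and $l_2\in\mathrm{pos}(r)$. $P$ is acyclic if its dependency graph has no directed cycle. A literal $l_1$ depends on a literal $l_2$ if the dependency graph has a directed path (with at least one edge) from $l_2$ to $l_1$. $P$ is cr-independent if for all cr-literals $l_1,l_2$ of $P$, $l_1$ does not depend on $l_2$. *)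

theory Defs
  imports Main
begin

datatype 'a literal = Pos 'a | Neg 'a

fun complement :: "'a literal \<Rightarrow> 'a literal" where
  "complement (Pos a) = Neg a"
| "complement (Neg a) = Pos a"

definition consistent_context :: "'a literal set \<Rightarrow> bool" where
  "consistent_context X \<longleftrightarrow> (\<forall>l\<in>X. complement l \<notin> X)"

text \<open>
  \<open>Rule H B N\<close> is the regular rule whose head is the disjunction of the literals in \<open>H\<close>, and
  whose body consists of the literals in \<open>B\<close> and of \<open>not l\<close> for the literals \<open>l\<close> in \<open>N\<close>.
  That \<open>H\<close> is nonempty is part of the program predicates below.
\<close>

datatype 'a rule =
  Rule (head_list: "'a literal list") (pos_list: "'a literal list") (neg_list: "'a literal list")

definition head :: "'a rule \<Rightarrow> 'a literal set" where
  "head r = set (head_list r)"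

definition pos :: "'a rule \<Rightarrow> 'a literal set" where
  "pos r = set (pos_list r)"

definition neg :: "'a rule \<Rightarrow> 'a literal set" where
  "neg r = set (neg_list r)"

definition fires :: "'a literal set \<Rightarrow> 'a rule \<Rightarrow> bool" where
  "fires X r \<longleftrightarrow> pos r \<subseteq> X \<and> neg r \<inter> X = {}"

definition satisfies_rule :: "'a literal set \<Rightarrow> 'a rule \<Rightarrow> bool" where
  "satisfies_rule X r \<longleftrightarrow> (fires X r \<longrightarrow> head r \<inter> X \<noteq> {})"

definition satisfies :: "'a literal set \<Rightarrow> 'a rule set \<Rightarrow> bool" where
  "satisfies X P \<longleftrightarrow> (\<forall>r\<in>P. satisfies_rule X r)"

definition a_prolog_program :: "'a rule set \<Rightarrow> bool" where
  "a_prolog_program P \<longleftrightarrow> finite P \<and> (\<forall>r\<in>P. head_list r \<noteq> [])"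

text \<open>
  The notion of answer set for programs without default negation. It is only meant for, and only
  applied to, such programs (reducts in particular).
\<close>

definition answer_set_pos :: "'a rule set \<Rightarrow> 'a literal set \<Rightarrow> bool" where
  "answer_set_pos P X \<longleftrightarrow>
     consistent_context X \<and> satisfies X P \<and> \<not> (\<exists>Y. Y \<subset> X \<and> satisfies Y P)"

definition reduct :: "'a rule set \<Rightarrow> 'a literal set \<Rightarrow> 'a rule set" where
  "reduct P X = (\<lambda>r. Rule (head_list r) (pos_list r) []) ` {r \<in> P. neg r \<inter> X = {}}"

definition answer_set :: "'a rule set \<Rightarrow> 'a literal set \<Rightarrow> bool" where
  "answer_set P X \<longleftrightarrow> answer_set_pos (reduct P X) X"

definition consistent_program :: "'a rule set \<Rightarrow> bool" where
  "consistent_program P \<longleftrightarrow> (\<exists>X. answer_set P X)"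

datatype 'a cr_rule =
  CR_Rule (cr_literal: "'a literal") (cr_pos_list: "'a literal list") (cr_neg_list: "'a literal list")

definition app :: "'a cr_rule \<Rightarrow> 'a rule" where
  "app r = Rule [cr_literal r] (cr_pos_list r) (cr_neg_list r)"

datatype 'a program = Program (reg: "'a rule set") (cr: "'a cr_rule set")

definition cr_prolog_program :: "'a program \<Rightarrow> bool" where
  "cr_prolog_program P \<longleftrightarrow> a_prolog_program (reg P) \<and> finite (cr P)"

definition abductive_support :: "'a program \<Rightarrow> 'a cr_rule set \<Rightarrow> bool" where
  "abductive_support P R \<longleftrightarrow>
     R \<subseteq> cr P \<and> consistent_program (reg P \<union> app ` R) \<and>
     \<not> (\<exists>R'. R' \<subseteq> cr P \<and> card R' < card R \<and> consistent_program (reg P \<union> app ` R'))"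

definition cr_answer_set :: "'a program \<Rightarrow> 'a literal set \<Rightarrow> bool" where
  "cr_answer_set P X \<longleftrightarrow> (\<exists>R. abductive_support P R \<and> answer_set (reg P \<union> app ` R) X)"

text \<open>
  The dependency graph is given by its edge relation, a pair \<open>(l2, l1)\<close> being an edge from \<open>l2\<close>
  to \<open>l1\<close>. Its vertices are the literals of the program; both endpoints of an edge are among
  them, so the vertex set matters neither for cycles nor for paths with at least one edge.
  A cr-rule has the same head and the same positive body as its application.
\<close>

definition dependency_graph :: "'a program \<Rightarrow> ('a literal \<times> 'a literal) set" where
  "dependency_graph P =
     {(l2, l1). \<exists>r \<in> reg P \<union> app ` cr P. l1 \<in> head r \<and> l2 \<in> pos r}"

definition acyclic_program :: "'a program \<Rightarrow> bool" where
  "acyclic_program P \<longleftrightarrow> acyclic (dependency_graph P)"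

definition depends_on :: "'a program \<Rightarrow> 'a literal \<Rightarrow> 'a literal \<Rightarrow> bool" where
  "depends_on P l1 l2 \<longleftrightarrow> (l2, l1) \<in> (dependency_graph P)\<^sup>+"

definition cr_independent :: "'a program \<Rightarrow> bool" where
  "cr_independent P \<longleftrightarrow>
     (\<forall>l1 \<in> cr_literal ` cr P. \<forall>l2 \<in> cr_literal ` cr P. \<not> depends_on P l1 l2)"

definition antichain_property :: "'a program \<Rightarrow> bool" where
  "antichain_property P \<longleftrightarrow>
     (\<forall>X1 X2. cr_answer_set P X1 \<longrightarrow> cr_answer_set P X2 \<longrightarrow> X1 \<subseteq> X2 \<longrightarrow> X1 = X2)"

end

(* For an acyclic program, the answer sets are exactly the consistent models X in which every
   literal l is supported: some firing rule has l as the only head literal in X. Hence, by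
   minimality of an abductive support R, each rule of R is the only support of its head, and the
   rules of R have pairwise distinct heads.

   Let X1 < X2 be answer sets with supports R1, R2 and sets of heads H1, H2, so that
   |H1| = |R1| = |R2| >= |H2|. Take p in X2 - X1. A regular rule supporting p in X2 has a positive
   body literal in X2 - X1, because otherwise it would fire in X1 and put p into X1. Descending
   along the dependency graph one reaches a literal of H2 outside X1. So H2 is not contained in X1,
   hence H1 is not contained in H2. A literal h in H1 - H2 is supported in X2 by a regular rule,
   which does not support h in X1, so that again it has a positive body literal in X2 - X1. The
   same descent shows that the cr-literal h depends on a cr-literal. *)

theory Submission imports Defs begin

definition supported :: "'a rule set \<Rightarrow> 'a literal set \<Rightarrow> 'a literal \<Rightarrow> bool" where
  "supported P X l \<longleftrightarrow> (\<exists>r\<in>P. fires X r \<and> head r \<inter> X = {l})"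

lemma satisfies_reduct_iff:
  "satisfies Y (reduct P X) \<longleftrightarrow>
     (\<forall>r\<in>P. neg r \<inter> X = {} \<longrightarrow> pos r \<subseteq> Y \<longrightarrow> head r \<inter> Y \<noteq> {})"
  by (auto simp: satisfies_def satisfies_rule_def reduct_def fires_def head_def pos_def neg_def)

lemma satisfies_reduct_self_iff: "satisfies X (reduct P X) \<longleftrightarrow> satisfies X P"
  unfolding satisfies_reduct_iff by (auto simp: satisfies_def satisfies_rule_def fires_def)

lemma answer_set_satisfies: "answer_set P X \<Longrightarrow> satisfies X P"
  by (simp add: answer_set_def answer_set_pos_def satisfies_reduct_self_iff)

lemma answer_set_consistent: "answer_set P X \<Longrightarrow> consistent_context X"
  by (simp add: answer_set_def answer_set_pos_def)

text \<open>If no firing rule had \<open>l\<close> as its only true head literal,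
  \<open>X - {l}\<close> would still satisfy the reduct, against minimality.\<close>

lemma answer_set_supported:
  assumes "answer_set P X" and "l \<in> X"
  shows "supported P X l"
proof (rule ccontr)
  assume unsupported: "\<not> supported P X l"
  have "satisfies (X - {l}) (reduct P X)"
    unfolding satisfies_reduct_iff
  proof (intro ballI impI)
    fix r assume r: "r \<in> P" "neg r \<inter> X = {}" "pos r \<subseteq> X - {l}"
    then have "fires X r"
      by (auto simp: fires_def)
    with r(1) answer_set_satisfies[OF assms(1)] unsupported
    have "head r \<inter> X \<noteq> {}" "head r \<inter> X \<noteq> {l}"
      by (auto simp: satisfies_def satisfies_rule_def supported_def)
    then show "head r \<inter> (X - {l}) \<noteq> {}"
      by blast
  qed
  moreover have "X - {l} \<subset> X"
    using assms(2) by blast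
  ultimately show False
    using assms(1) by (auto simp: answer_set_def answer_set_pos_def)
qed

text \<open>Well-founded induction puts the positive body of a supporting rule into any smaller
  model \<open>Y\<close> of the reduct, and then its head literal. \<open>D\<close> is kept separate
  from \<open>P\<close> so that subprograms can use the graph of the whole program.\<close>

lemma supported_answer_set:
  assumes wf: "wf D" and edges: "\<And>r. r \<in> P \<Longrightarrow> pos r \<times> head r \<subseteq> D"
    and "consistent_context X" and "satisfies X P"
    and supp: "\<And>l. l \<in> X \<Longrightarrow> supported P X l"
  shows "answer_set P X"
proof -
  have "X \<subseteq> Y" if Y: "Y \<subseteq> X" "satisfies Y (reduct P X)" for Y
  proof
    fix l assume "l \<in> X"
    with wf show "l \<in> Y"
    proof (induction l rule: wf_induct_rule)
      case (less l)
      obtain r where r: "r \<in> P" "fires X r" "head r \<inter> X = {l}"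
        using supp[OF less.prems] by (auto simp: supported_def)
      have "pos r \<subseteq> Y"
      proof
        fix p assume "p \<in> pos r"
        with r edges[OF r(1)] have "(p, l) \<in> D" "p \<in> X"
          by (auto simp: fires_def)
        then show "p \<in> Y"
          by (rule less.IH)
      qed
      with Y(2) r(1,2) have "head r \<inter> Y \<noteq> {}"
        by (auto simp: satisfies_reduct_iff fires_def)
      then obtain l' where "l' \<in> head r" "l' \<in> Y"
        by blast
      with r(3) Y(1) show "l \<in> Y"
        by auto
    qed
  qed
  with assms(3,4) show ?thesis
    unfolding answer_set_def answer_set_pos_def satisfies_reduct_self_iff by blast
qed

lemma finite_dependency_graph:
  assumes "cr_prolog_program P"
  shows "finite (dependency_graph P)"
proof -
  have "dependency_graph P = (\<Union>r \<in> reg P \<union> app ` cr P. pos r \<times> head r)"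
    by (auto simp: dependency_graph_def)
  then show ?thesis
    using assms
    by (auto simp: cr_prolog_program_def a_prolog_program_def pos_def head_def)
qed

lemma wf_dependency_graph:
  assumes "cr_prolog_program P" and "acyclic_program P"
  shows "wf (dependency_graph P)"
  using assms finite_dependency_graph finite_acyclic_wf by (auto simp: acyclic_program_def)

lemma head_app [simp]: "head (app r) = {cr_literal r}"
  by (simp add: head_def app_def)

text \<open>Minimality of \<open>R\<close> prevents \<open>X\<close> from being an answer set once
  \<open>r\<close> is dropped. All other literals keep their support, so the obstruction must be the
  head of \<open>r\<close>.\<close>

lemma abductive_support_irredundant:
  assumes "cr_prolog_program P" and "acyclic_program P"
    and R: "abductive_support P R" and X: "answer_set (reg P \<union> app ` R) X" and "r \<in> R"
  shows "cr_literal r \<in> X" and "\<not> supported (reg P \<union> app ` (R - {r})) X (cr_literal r)"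
proof -
  let ?Q = "reg P \<union> app ` (R - {r})"
  have sub: "R \<subseteq> cr P"
    using R by (simp add: abductive_support_def)
  have "finite R"
    using sub assms(1) finite_subset by (auto simp: cr_prolog_program_def)
  with \<open>r \<in> R\<close> have "card (R - {r}) < card R"
    by (intro psubset_card_mono) auto
  with R sub have not_as: "\<not> answer_set ?Q X"
    by (auto simp: abductive_support_def consistent_program_def)
  have "supported ?Q X l" if l: "l \<in> X" "l \<noteq> cr_literal r" for l
  proof -
    obtain q where q: "q \<in> reg P \<union> app ` R" "fires X q" "head q \<inter> X = {l}"
      using answer_set_supported[OF X l(1)] by (auto simp: supported_def)
    from q(3) l have "q \<noteq> app r"
      by (auto simp: Int_insert_left split: if_splits)
    with q show ?thesis
      unfolding supported_def by blast
  qed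
  moreover have "answer_set ?Q X" if "\<And>l. l \<in> X \<Longrightarrow> supported ?Q X l"
  proof (rule supported_answer_set)
    show "wf (dependency_graph P)"
      using assms(1,2) by (rule wf_dependency_graph)
    show "pos q \<times> head q \<subseteq> dependency_graph P" if "q \<in> ?Q" for q
      using that sub by (auto simp: dependency_graph_def)
    show "satisfies X ?Q"
      using answer_set_satisfies[OF X] by (auto simp: satisfies_def)
  qed (use answer_set_consistent[OF X] that in auto)
  ultimately show "cr_literal r \<in> X" "\<not> supported ?Q X (cr_literal r)"
    using not_as by metis+
qed

lemma abductive_support_inj_on:
  assumes "cr_prolog_program P" and "acyclic_program P"
    and "abductive_support P R" and X: "answer_set (reg P \<union> app ` R) X"
  shows "inj_on cr_literal R"
proof (rule inj_onI, rule ccontr)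
  fix r s assume rs: "r \<in> R" "s \<in> R" "cr_literal r = cr_literal s" "r \<noteq> s"
  note irred = abductive_support_irredundant[OF assms]
  obtain q where q: "q \<in> reg P \<union> app ` R" "fires X q" "head q \<inter> X = {cr_literal r}"
    using answer_set_supported[OF X irred(1)[OF rs(1)]] by (auto simp: supported_def)
  \<comment> \<open>One rule cannot come from both \<open>r\<close> and \<open>s\<close> alone, so
    \<open>q\<close> survives the removal of at least one of them.\<close>
  from q(1) rs(4) have "q \<in> reg P \<union> app ` (R - {r}) \<or> q \<in> reg P \<union> app ` (R - {s})"
    by blast
  with q irred(2)[OF rs(1)] irred(2)[OF rs(2)] rs(3) show False
    unfolding supported_def by metis
qed

text \<open>Each regular support leads back along an edge to another literal of
  \<open>X2 - X1\<close>; well-foundedness forces the descent to end at a cr-rule. The path may be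
  empty, as \<open>p\<close> itself may be the head of that rule.\<close>

lemma descent_to_cr_literal:
  assumes wf: "wf (dependency_graph P)"
    and X1: "satisfies X1 (reg P)" and X2: "answer_set (reg P \<union> app ` R) X2"
    and "X1 \<subseteq> X2" and "p \<in> X2 - X1"
  shows "\<exists>c \<in> cr_literal ` R - X1. (c, p) \<in> (dependency_graph P)\<^sup>*"
  using wf \<open>p \<in> X2 - X1\<close>
proof (induction p rule: wf_induct_rule)
  case (less p)
  obtain q where q: "q \<in> reg P \<union> app ` R" "fires X2 q" "head q \<inter> X2 = {p}"
    using answer_set_supported[OF X2, of p] less.prems unfolding supported_def by blast
  show ?case
  proof (cases "q \<in> reg P")
    case True
    have "head q \<inter> X1 = {}"
      using q(3) less.prems \<open>X1 \<subseteq> X2\<close> by fastforce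
    with True X1 have "\<not> fires X1 q"
      by (auto simp: satisfies_def satisfies_rule_def)
    \<comment> \<open>The condition on \<open>neg q\<close> passes from \<open>X2\<close> to its
      subset \<open>X1\<close>, so only the positive body can fail there.\<close>
    with q(2) \<open>X1 \<subseteq> X2\<close> obtain p' where p': "p' \<in> pos q" "p' \<in> X2 - X1"
      unfolding fires_def by blast
    have edge: "(p', p) \<in> dependency_graph P"
      using True p'(1) q(3) by (auto simp: dependency_graph_def)
    show ?thesis
      using less.IH[OF edge p'(2)] edge by (meson rtrancl.rtrancl_into_rtrancl)
  next
    case False
    with q less.prems show ?thesis
      by (auto simp: Int_insert_left split: if_splits)
  qed
qed

lemma abductive_support_card_eq:
  "abductive_support P R \<Longrightarrow> abductive_support P S \<Longrightarrow> card R = card S"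
  unfolding abductive_support_def by (metis linorder_neqE_nat)

theorem theorem1:
  fixes P :: "'a program"
  assumes "cr_prolog_program P"
    and "acyclic_program P"
    and "cr_independent P"
  shows "antichain_property P"
  unfolding antichain_property_def
proof (intro allI impI, rule ccontr)
  fix X1 X2
  assume as: "cr_answer_set P X1" "cr_answer_set P X2" and sub: "X1 \<subseteq> X2" and "X1 \<noteq> X2"
  from as obtain R1 R2 where
    R1: "abductive_support P R1" and X1: "answer_set (reg P \<union> app ` R1) X1" and
    R2: "abductive_support P R2" and X2: "answer_set (reg P \<union> app ` R2) X2"
    unfolding cr_answer_set_def by blast
  have cr: "R1 \<subseteq> cr P" "R2 \<subseteq> cr P"
    using R1 R2 by (simp_all add: abductive_support_def)
  have fin: "finite R2"
    using cr assms(1) finite_subset by (auto simp: cr_prolog_program_def)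
  have sat: "satisfies X1 (reg P)"
    using answer_set_satisfies[OF X1] by (simp add: satisfies_def)
  note descent =
    descent_to_cr_literal[OF wf_dependency_graph[OF assms(1,2)] sat X2 sub]
  note irred = abductive_support_irredundant[OF assms(1,2) R1 X1]
  have "\<not> cr_literal ` R2 \<subseteq> X1"
    using descent sub \<open>X1 \<noteq> X2\<close> by blast
  moreover have "cr_literal ` R1 \<subseteq> X1"
    using irred(1) by blast
  moreover have "card (cr_literal ` R2) \<le> card (cr_literal ` R1)"
    using card_image_le[OF fin, of cr_literal] abductive_support_card_eq[OF R1 R2]
      card_image[OF abductive_support_inj_on[OF assms(1,2) R1 X1]] by simp
  \<comment> \<open>Inclusion would give equality by cardinality, yet only the heads of
    \<open>R1\<close> all lie in \<open>X1\<close>.\<close>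
  ultimately have "\<not> cr_literal ` R1 \<subseteq> cr_literal ` R2"
    using fin by (metis card_seteq finite_imageI)
  then obtain r where r: "r \<in> R1" "cr_literal r \<notin> cr_literal ` R2"
    by blast
  let ?h = "cr_literal r"
  obtain q where q: "q \<in> reg P \<union> app ` R2" "fires X2 q" "head q \<inter> X2 = {?h}"
    using answer_set_supported[OF X2, of ?h] irred(1)[OF r(1)] sub unfolding supported_def by blast
  have regular: "q \<in> reg P"
    using q r(2) by (fastforce simp: Int_insert_left image_iff split: if_splits)
  have "head q \<inter> X1 = {?h}"
    using q(3) irred(1)[OF r(1)] sub by blast
  \<comment> \<open>Being regular, \<open>q\<close> remains after \<open>r\<close> is removed;
    firing in \<open>X1\<close>, it would make \<open>r\<close> redundant.\<close>
  with regular irred(2)[OF r(1)] have "\<not> fires X1 q"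
    by (auto simp: supported_def)
  with q(2) sub obtain p where p: "p \<in> pos q" "p \<in> X2 - X1"
    unfolding fires_def by blast
  have "(p, ?h) \<in> dependency_graph P"
    using regular p(1) q(3) by (auto simp: dependency_graph_def)
  moreover obtain c where c: "c \<in> cr_literal ` R2" "(c, p) \<in> (dependency_graph P)\<^sup>*"
    using descent[OF p(2)] by blast
  \<comment> \<open>The final edge into \<open>?h\<close> makes the path nonempty even if
    \<open>c = p\<close>.\<close>
  ultimately have "depends_on P ?h c"
    unfolding depends_on_def by (meson rtrancl_into_trancl1)
  with assms(3) c(1) r(1) cr show False
    unfolding cr_independent_def by blast
qed

end
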